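(* If $G$ is an infinite discrete Abelian group and $E$ is a Banach space over $\mathbb{C}$ of infinite dimension, then spectral analysis does not hold in $E^G$.
   Context: For $G$ discrete, $E^G=C(G,E)$ is the space of all functions $f\colon G\to E$, equipped with the topology of uniform convergence on compact (i.e. finite) subsets of $G$, where $E$ carries its norm. A variety in $E^G$ is a closed linear subspace that is translation invariant, i.e. contains $T_g f$ (where $T_g f(x)=f(x+g)$) for every $g\in G$ whenever it contains $f$. An exponential is a function $m\colon G\to\mathbb{C}$ with $m\neq 0$ and $m(x+y)=m(x)m(y)$ for all $x,y\in G$. Spectral analysis holds in $E^G$ if every nonzero variety in $E^G$ contains a function of the form $m\cdot e$, where $m$ is an exponential and $e\in E$, $e\ne 0$. *)

theory Defs
  imports "HOL-Analysis.Analysis" "HOL-Library.Function_Algebras"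
begin

class complex_vector = ab_group_add +
  fixes scaleC :: "complex \<Rightarrow> 'a \<Rightarrow> 'a"  (infixr "*\<^sub>C" 75)
  assumes scaleC_add_right: "a *\<^sub>C (x + y) = a *\<^sub>C x + a *\<^sub>C y"
    and scaleC_add_left: "(a + b) *\<^sub>C x = a *\<^sub>C x + b *\<^sub>C x"
    and scaleC_scaleC: "a *\<^sub>C (b *\<^sub>C x) = (a * b) *\<^sub>C x"
    and scaleC_one: "1 *\<^sub>C x = x"

global_interpretation complex_vector:
  vector_space "scaleC :: complex \<Rightarrow> 'a \<Rightarrow> 'a::complex_vector"
  by unfold_locales (simp_all add: scaleC_add_right scaleC_add_left scaleC_scaleC scaleC_one)

text \<open>The norm, metric and completeness come from \<^class>\<open>banach\<close>, a class of real spaces;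
  complex scalar multiplication must extend the real one and be compatible with the norm.\<close>

class complex_banach = complex_vector + banach +
  assumes scaleR_scaleC: "r *\<^sub>R x = complex_of_real r *\<^sub>C x"
    and norm_scaleC: "norm (a *\<^sub>C x) = cmod a * norm x"

instantiation "fun" :: (type, complex_vector) complex_vector
begin

definition scaleC_fun :: "complex \<Rightarrow> ('a \<Rightarrow> 'b) \<Rightarrow> 'a \<Rightarrow> 'b"
  where "scaleC_fun a f = (\<lambda>x. a *\<^sub>C f x)"

instance
  by standard
    (simp_all add: scaleC_fun_def fun_eq_iff scaleC_add_right scaleC_add_left scaleC_scaleC
      scaleC_one)

end

definition infinite_dimensional :: "'e::complex_vector itself \<Rightarrow> bool"
  where "infinite_dimensional _ \<longleftrightarrow>
    \<not> (\<exists>B :: 'e set. finite B \<and> complex_vector.span B = UNIV)"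

text \<open>\<open>G\<close> is discrete, so its compact subsets are the finite ones, and every function
  on \<open>G\<close> is continuous.\<close>

definition finite_convergence_topology :: "('g \<Rightarrow> 'e::real_normed_vector) topology"
  where "finite_convergence_topology = topology (\<lambda>U. \<forall>f\<in>U. \<exists>K \<epsilon>.
    finite K \<and> \<epsilon> > 0 \<and> {h. \<forall>x\<in>K. norm (h x - f x) < \<epsilon>} \<subseteq> U)"

lemma openin_finite_convergence_topology:
  "openin finite_convergence_topology U \<longleftrightarrow> (\<forall>f\<in>U. \<exists>K \<epsilon>.
    finite K \<and> \<epsilon> > 0 \<and> {h. \<forall>x\<in>K. norm (h x - f x) < \<epsilon>} \<subseteq> U)"
proof -
  let ?N = "\<lambda>K \<epsilon> f. {h :: 'a \<Rightarrow> 'b. \<forall>x\<in>K. norm (h x - f x) < \<epsilon>}"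
  let ?P = "\<lambda>U. \<forall>f\<in>U. \<exists>K \<epsilon>. finite K \<and> \<epsilon> > 0 \<and> ?N K \<epsilon> f \<subseteq> U"
  have "?P (S \<inter> T)" if S: "?P S" and T: "?P T" for S T
  proof
    fix f assume f: "f \<in> S \<inter> T"
    obtain K \<epsilon> where K: "finite K" "\<epsilon> > 0" "?N K \<epsilon> f \<subseteq> S"
      using S f by blast
    obtain L \<delta> where L: "finite L" "\<delta> > 0" "?N L \<delta> f \<subseteq> T"
      using T f by blast
    have "?N (K \<union> L) (min \<epsilon> \<delta>) f \<subseteq> ?N K \<epsilon> f \<inter> ?N L \<delta> f"
      by auto
    then have "?N (K \<union> L) (min \<epsilon> \<delta>) f \<subseteq> S \<inter> T"
      using K(3) L(3) by blast
    then show "\<exists>K \<epsilon>. finite K \<and> \<epsilon> > 0 \<and> ?N K \<epsilon> f \<subseteq> S \<inter> T"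
      using K L by (intro exI[of _ "K \<union> L"] exI[of _ "min \<epsilon> \<delta>"]) simp
  qed
  moreover have "?P (\<Union>\<K>)" if "\<forall>S\<in>\<K>. ?P S" for \<K>
    using that by (meson Union_iff Union_upper order_trans)
  ultimately have "istopology ?P"
    unfolding istopology_def by blast
  then show ?thesis
    by (simp add: finite_convergence_topology_def topology_inverse')
qed

lemma topspace_finite_convergence_topology [simp]:
  "topspace finite_convergence_topology = UNIV"
proof -
  have "openin finite_convergence_topology (UNIV :: ('a \<Rightarrow> 'b) set)"
    unfolding openin_finite_convergence_topology using zero_less_one by blast
  then show ?thesis
    using openin_subset by blast
qed

definition translate :: "'g::ab_group_add \<Rightarrow> ('g \<Rightarrow> 'e) \<Rightarrow> 'g \<Rightarrow> 'e"
  where "translate g f = (\<lambda>x. f (x + g))"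

definition variety :: "('g::ab_group_add \<Rightarrow> 'e::complex_banach) set \<Rightarrow> bool"
  where "variety V \<longleftrightarrow>
    closedin finite_convergence_topology V \<and>
    complex_vector.subspace V \<and>
    (\<forall>f\<in>V. \<forall>g. translate g f \<in> V)"

definition exponential :: "('g::ab_group_add \<Rightarrow> complex) \<Rightarrow> bool"
  where "exponential m \<longleftrightarrow> m \<noteq> 0 \<and> (\<forall>x y. m (x + y) = m x * m y)"

definition spectral_analysis ::
    "'g::ab_group_add itself \<Rightarrow> 'e::complex_banach itself \<Rightarrow> bool"
  where "spectral_analysis _ _ \<longleftrightarrow>
    (\<forall>V :: ('g \<Rightarrow> 'e) set. variety V \<and> V \<noteq> {0} \<longrightarrow>
      (\<exists>m e. exponential m \<and> e \<noteq> 0 \<and> (\<lambda>x. m x *\<^sub>C e) \<in> V))"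

end

theory Submission
  imports Defs
begin

text \<open>
  The idea is to find a variety whose elements are shifted along a sequence of coordinates.
  Suppose that vectors \<open>e\<^sub>h\<close> and bounded functionals \<open>\<phi>\<^sub>h\<close> are indexed by a
  countably infinite subgroup \<open>H\<close> of \<open>G\<close>, that they are biorthogonal, and that the functionals
  separate the points of a closed subspace \<open>E\<^sub>0\<close> which contains the vectors.
  The functions \<open>f\<close> with values in \<open>E\<^sub>0\<close> and
  \<open>\<phi>\<^bsub>h + k\<^esub> (f (g + k)) = \<phi>\<^sub>h (f g)\<close> for \<open>h, k \<in> H\<close>, \<open>g \<in> G\<close> form a variety.
  It is nonzero, for it contains \<open>h \<mapsto> e\<^sub>h\<close>, extended by \<open>0\<close> outside \<open>H\<close>.
  If it contains \<open>m \<cdot> v\<close> with \<open>m\<close> an exponential, then \<open>m h * \<phi>\<^sub>h v = \<phi>\<^sub>0 v\<close> for all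
  \<open>h \<in> H\<close>.  Either \<open>\<phi>\<^sub>0 v = 0\<close>, and then all coordinates of \<open>v\<close> vanish and \<open>v = 0\<close>; or
  \<open>\<phi>\<^sub>0 v \<noteq> 0\<close>.  In the second case rescale the system beforehand so that the norms of the
  functionals tend to \<open>0\<close>: then \<open>\<bar>m h\<bar> \<le> 1\<close> for finitely many \<open>h \<in> H\<close> only, which is absurd
  because \<open>m h * m (- h) = 1\<close> puts \<open>h\<close> or \<open>- h\<close> among these for every \<open>h\<close>.

  The rest is the construction of the system.  Norming functionals come from a
  Hahn--Banach argument (\<open>norming_functional\<close>); a countable dense subset turns them into a
  sequence that separates the points of an infinite-dimensional separable subspace
  (\<open>separable_total_functionals\<close>).  A one-sided Gram--Schmidt process then makes this
  sequence biorthogonal to a sequence of vectors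
  (\<open>biorthogonal_system_of_total_functionals\<close>).
\<close>

section \<open>Norming functionals\<close>

definition sublinear :: "('a::real_vector \<Rightarrow> real) \<Rightarrow> bool"
  where "sublinear p \<longleftrightarrow>
    (\<forall>x y. p (x + y) \<le> p x + p y) \<and> (\<forall>c x. 0 < c \<longrightarrow> p (c *\<^sub>R x) \<le> c * p x)"

lemma sublinear_add: "sublinear p \<Longrightarrow> p (x + y) \<le> p x + p y"
  and sublinear_scale_le: "sublinear p \<Longrightarrow> 0 < c \<Longrightarrow> p (c *\<^sub>R x) \<le> c * p x"
  by (auto simp: sublinear_def)

lemma sublinear_zero:
  assumes "sublinear p"
  shows "p 0 = 0"
  using sublinear_add[OF assms, of 0 0] sublinear_scale_le[OF assms, of "1/2" 0] by simp

lemma sublinear_minus: "sublinear p \<Longrightarrow> - p (- x) \<le> p x"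
  using sublinear_add[of p x "- x"] sublinear_zero[of p] by simp

lemma sublinear_scale:
  assumes p: "sublinear p" and c: "0 \<le> c"
  shows "p (c *\<^sub>R x) = c * p x"
proof (cases "c = 0")
  case False
  then have c: "0 < c" using c by simp
  have "p x \<le> inverse c * p (c *\<^sub>R x)"
    using sublinear_scale_le[OF p, of "inverse c" "c *\<^sub>R x"] c by simp
  then have "c * p x \<le> p (c *\<^sub>R x)"
    using c by (simp add: field_simps)
  with sublinear_scale_le[OF p c, of x] show ?thesis by simp
qed (simp add: sublinear_zero[OF p])

lemma sublinear_norm: "sublinear norm"
  by (simp add: sublinear_def norm_triangle_ineq)

text \<open>The largest sublinear functional below \<open>p\<close> whose value at \<open>- u\<close> is at most \<open>- p u\<close>.
  A sublinear functional is linear as soon as it is odd, so lowering it in this way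
  repairs linearity in the direction \<open>u\<close>.\<close>

definition lower_along :: "('a::real_vector \<Rightarrow> real) \<Rightarrow> 'a \<Rightarrow> 'a \<Rightarrow> real"
  where "lower_along p u y = (INF t\<in>{0..}. p (y + t *\<^sub>R u) - t * p u)"

lemma
  assumes p: "sublinear p"
  shows lower_along_le: "0 \<le> t \<Longrightarrow> lower_along p u y \<le> p (y + t *\<^sub>R u) - t * p u"
    and sublinear_lower_along: "sublinear (lower_along p u)"
proof -
  have bdd: "bdd_below ((\<lambda>t. p (y + t *\<^sub>R u) - t * p u) ` {0..})" for y
  proof (rule bdd_belowI2)
    fix t :: real assume "t \<in> {0..}"
    then show "- p (- y) \<le> p (y + t *\<^sub>R u) - t * p u"
      using sublinear_add[OF p, of "y + t *\<^sub>R u" "- y"] sublinear_scale[OF p, of t u] by simp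
  qed
  have le: "lower_along p u y \<le> p (y + t *\<^sub>R u) - t * p u" if "0 \<le> t" for t y
    unfolding lower_along_def using that by (intro cINF_lower bdd) auto
  then show "0 \<le> t \<Longrightarrow> lower_along p u y \<le> p (y + t *\<^sub>R u) - t * p u" .
  have greatest: "a \<le> lower_along p u y"
    if "\<And>t. 0 \<le> t \<Longrightarrow> a \<le> p (y + t *\<^sub>R u) - t * p u" for a y
    unfolding lower_along_def using that by (intro cINF_greatest) auto
  show "sublinear (lower_along p u)"
    unfolding sublinear_def
  proof (intro conjI allI impI)
    fix y z
    have "lower_along p u (y + z) - (p (z + s *\<^sub>R u) - s * p u) \<le> p (y + t *\<^sub>R u) - t * p u"
      if "0 \<le> s" "0 \<le> t" for s t
      using le[of "s + t" "y + z"] sublinear_add[OF p, of "y + t *\<^sub>R u" "z + s *\<^sub>R u"] that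
      by (simp add: algebra_simps)
    then have "lower_along p u (y + z) - (p (z + s *\<^sub>R u) - s * p u) \<le> lower_along p u y"
      if "0 \<le> s" for s
      using that by (intro greatest)
    then have "lower_along p u (y + z) - lower_along p u y \<le> p (z + s *\<^sub>R u) - s * p u"
      if "0 \<le> s" for s
      using that by (simp add: algebra_simps)
    then have "lower_along p u (y + z) - lower_along p u y \<le> lower_along p u z"
      by (intro greatest)
    then show "lower_along p u (y + z) \<le> lower_along p u y + lower_along p u z"
      by simp
  next
    fix c :: real and y assume c: "0 < c"
    have "lower_along p u (c *\<^sub>R y) / c \<le> p (y + t *\<^sub>R u) - t * p u" if "0 \<le> t" for t
    proof -
      have "lower_along p u (c *\<^sub>R y) \<le> p (c *\<^sub>R (y + t *\<^sub>R u)) - c * t * p u"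
        using le[of "c * t" "c *\<^sub>R y"] c that by (simp add: algebra_simps)
      also have "\<dots> \<le> c * (p (y + t *\<^sub>R u) - t * p u)"
        using sublinear_scale_le[OF p c, of "y + t *\<^sub>R u"] by (simp add: algebra_simps)
      finally show ?thesis using c by (simp add: field_simps)
    qed
    then have "lower_along p u (c *\<^sub>R y) / c \<le> lower_along p u y"
      by (intro greatest)
    then show "lower_along p u (c *\<^sub>R y) \<le> c * lower_along p u y"
      using c by (simp add: field_simps)
  qed
qed

lemma lower_along_le_self: "sublinear p \<Longrightarrow> lower_along p u y \<le> p y"
  using lower_along_le[of p 0 u y] by simp

lemma lower_along_minus: "sublinear p \<Longrightarrow> lower_along p u (- u) \<le> - p u"
  using lower_along_le[of p 1 u "- u"] sublinear_zero[of p] by simp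

text \<open>Zorn's lemma applies because the pointwise infimum of a chain of sublinear functionals is
  again sublinear; it is finite since \<open>- q (- x) \<le> - p (- x) \<le> p x\<close> whenever \<open>p \<le> q\<close>.\<close>

lemma minimal_sublinear_exists:
  assumes q: "sublinear q"
  obtains p where "sublinear p" "p \<le> q" "\<And>r. sublinear r \<Longrightarrow> r \<le> p \<Longrightarrow> r = p"
proof -
  define A where "A = {p. sublinear p \<and> p \<le> q}"
  have "\<exists>p\<in>A. \<forall>r\<in>A. p \<ge> r \<longrightarrow> r = p"
  proof (rule predicate_Zorn)
    show "partial_order_on A (relation_of (\<ge>) A)"
      by (rule partial_order_on_relation_ofI) auto
  next
    fix C assume "C \<in> Chains (relation_of (\<ge>) A)"
    then have CA: "C \<subseteq> A" and tot: "\<And>p r. p \<in> C \<Longrightarrow> r \<in> C \<Longrightarrow> p \<le> r \<or> r \<le> p"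
      by (auto simp: Chains_def relation_of_def)
    show "\<exists>u\<in>A. \<forall>a\<in>C. a \<ge> u"
    proof (cases "C = {}")
      case True
      then show ?thesis using q by (auto simp: A_def)
    next
      case ne: False
      have sub: "sublinear p" and leq: "p x \<le> q x" if "p \<in> C" for p x
        using CA that by (auto simp: A_def le_fun_def)
      define u where "u x = (INF p\<in>C. p x)" for x
      have bdd: "bdd_below ((\<lambda>p. p x) ` C)" for x
      proof (rule bdd_belowI2)
        fix p assume "p \<in> C"
        then show "- q (- x) \<le> p x"
          using sublinear_minus[OF sub, of p x] leq[of p "- x"] by simp
      qed
      have low: "u x \<le> p x" if "p \<in> C" for p x
        unfolding u_def using that by (intro cINF_lower bdd)
      have gr: "a \<le> u x" if "\<And>p. p \<in> C \<Longrightarrow> a \<le> p x" for a x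
        unfolding u_def using that ne by (intro cINF_greatest)
      have "sublinear u"
        unfolding sublinear_def
      proof (intro conjI allI impI)
        fix x y
        \<comment> \<open>Two members of the chain are comparable, and the smaller one serves for both summands.\<close>
        have "u (x + y) - r y \<le> p x" if pr: "p \<in> C" "r \<in> C" for p r
        proof -
          obtain s where s: "s \<in> C" "s \<le> p" "s \<le> r"
            using tot[OF pr] pr by auto
          have "u (x + y) \<le> s x + s y"
            using low[OF s(1), of "x + y"] sublinear_add[OF sub[OF s(1)], of x y] by simp
          also have "\<dots> \<le> p x + r y"
            using s by (intro add_mono) (auto simp: le_fun_def)
          finally show ?thesis by simp
        qed
        then have "u (x + y) - r y \<le> u x" if "r \<in> C" for r
          using that by (intro gr)
        then have "u (x + y) - u x \<le> r y" if "r \<in> C" for r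
          using that by (simp add: algebra_simps)
        then have "u (x + y) - u x \<le> u y"
          by (intro gr)
        then show "u (x + y) \<le> u x + u y" by simp
      next
        fix c :: real and x assume c: "0 < c"
        have "u (c *\<^sub>R x) / c \<le> p x" if "p \<in> C" for p
          using low[OF that, of "c *\<^sub>R x"] sublinear_scale_le[OF sub[OF that] c, of x] c
          by (simp add: field_simps)
        then have "u (c *\<^sub>R x) / c \<le> u x"
          by (intro gr)
        then show "u (c *\<^sub>R x) \<le> c * u x"
          using c by (simp add: field_simps)
      qed
      moreover have "u \<le> q"
        using ne low leq by (meson ex_in_conv le_funI order_trans)
      ultimately show ?thesis
        using low by (auto simp: A_def le_fun_def)
    qed
  qed
  then obtain p where "p \<in> A" "\<And>r. r \<in> A \<Longrightarrow> r \<le> p \<Longrightarrow> r = p"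
    by blast
  then show ?thesis
    using that[of p] by (auto simp: A_def intro: order_trans)
qed

text \<open>Lowering along \<open>u\<close> cannot change a minimal \<open>p\<close>, which therefore satisfies
  \<open>p (- u) \<le> - p u\<close> for every \<open>u\<close>.\<close>

lemma minimal_sublinear_linear:
  assumes p: "sublinear p" and min: "\<And>r. sublinear r \<Longrightarrow> r \<le> p \<Longrightarrow> r = p"
  shows "linear p"
proof -
  have odd: "p (- u) = - p u" for u
  proof -
    have "lower_along p u = p"
      using p by (intro min sublinear_lower_along le_funI lower_along_le_self)
    then show ?thesis
      using lower_along_minus[OF p, of u] sublinear_minus[OF p, of "- u"] by simp
  qed
  show ?thesis
  proof (rule linearI)
    fix x y
    show "p (x + y) = p x + p y"
      using sublinear_add[OF p, of x y] sublinear_add[OF p, of "- x" "- y"] odd[of x] odd[of y]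
        odd[of "x + y"] by (simp add: algebra_simps)
  next
    fix c :: real and x
    show "p (c *\<^sub>R x) = c *\<^sub>R p x"
    proof (cases "0 \<le> c")
      case False
      then show ?thesis
        using sublinear_scale[OF p, of "- c" x] odd[of "c *\<^sub>R x"] by simp
    qed (simp add: sublinear_scale[OF p])
  qed
qed

text \<open>Hahn--Banach by descent among sublinear functionals: the norm lowered along \<open>d\<close> is at
  most \<open>- norm d\<close> at \<open>- d\<close>, so every linear functional below it takes the value \<open>norm d\<close> at \<open>d\<close>.\<close>

lemma norming_real_functional:
  fixes d :: "'a::real_normed_vector"
  obtains f where "linear f" "\<And>x. \<bar>f x\<bar> \<le> norm x" "f d = norm d"
proof -
  let ?q = "lower_along norm d"
  obtain p where p: "sublinear p" "p \<le> ?q" "\<And>r. sublinear r \<Longrightarrow> r \<le> p \<Longrightarrow> r = p"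
    using minimal_sublinear_exists[OF sublinear_lower_along[OF sublinear_norm]] by blast
  then have lin: "linear p"
    by (intro minimal_sublinear_linear)
  have le: "p x \<le> norm x" for x
    using p(2) lower_along_le_self[OF sublinear_norm, of d x] by (meson le_funD order_trans)
  have abs: "\<bar>p x\<bar> \<le> norm x" for x
    using le[of x] le[of "- x"] by (simp add: linear_neg[OF lin] abs_le_iff)
  have "- p d \<le> - norm d"
    using p(2) lower_along_minus[OF sublinear_norm, of d]
    by (metis le_funD linear_neg[OF lin] order_trans)
  with le[of d] have "p d = norm d" by simp
  with lin abs show ?thesis using that by blast
qed

definition bounded_functional :: "('e::complex_banach \<Rightarrow> complex) \<Rightarrow> bool"
  where "bounded_functional \<phi> \<longleftrightarrow> bounded_linear \<phi> \<and> (\<forall>a x. \<phi> (a *\<^sub>C x) = a * \<phi> x)"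

text \<open>The complex functional with real part \<open>f\<close> is \<open>x \<mapsto> f x - \<i> f (\<i> x)\<close>.  The
  constant \<open>2\<close> is crude, but it is the same for all \<open>d\<close>, and this makes the functionals of a dense
  set of points \<open>d\<close> separate points.\<close>

lemma norming_functional:
  fixes d :: "'e::complex_banach"
  shows "\<exists>\<psi>. bounded_functional \<psi> \<and> (\<forall>x. cmod (\<psi> x) \<le> 2 * norm x) \<and> norm d \<le> cmod (\<psi> d)"
proof -
  obtain f where f: "linear f" "\<And>x::'e. \<bar>f x\<bar> \<le> norm x" "f d = norm d"
    using norming_real_functional by blast
  have i: "\<bar>f (\<i> *\<^sub>C x)\<bar> \<le> norm x" for x
    using f(2)[of "\<i> *\<^sub>C x"] by (simp add: norm_scaleC)
  define \<psi> where "\<psi> x = Complex (f x) (- f (\<i> *\<^sub>C x))" for x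
  have add: "\<psi> (x + y) = \<psi> x + \<psi> y" for x y
    by (simp add: \<psi>_def complex_eq_iff scaleC_add_right linear_add[OF f(1)])
  have real: "f (complex_of_real r *\<^sub>C x) = r * f x" for r x
    using linear_scale[OF f(1), of r x] by (simp add: scaleR_scaleC)
  have scale: "\<psi> (a *\<^sub>C x) = a * \<psi> x" for a x
  proof -
    have split: "f ((complex_of_real s + complex_of_real t * \<i>) *\<^sub>C x)
        = s * f x + t * f (\<i> *\<^sub>C x)" for s t
      using real[of s x] real[of t "\<i> *\<^sub>C x"]
      by (simp add: scaleC_add_left scaleC_scaleC linear_add[OF f(1)])
    have "a = complex_of_real (Re a) + complex_of_real (Im a) * \<i>"
      by (simp add: complex_eq_iff)
    then have "f (a *\<^sub>C x) = Re a * f x + Im a * f (\<i> *\<^sub>C x)"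
      using split[of "Re a" "Im a"] by simp
    moreover have "\<i> * a = complex_of_real (- Im a) + complex_of_real (Re a) * \<i>"
      by (simp add: complex_eq_iff)
    then have "f (\<i> *\<^sub>C a *\<^sub>C x) = - Im a * f x + Re a * f (\<i> *\<^sub>C x)"
      using split[of "- Im a" "Re a"] by (simp add: scaleC_scaleC)
    ultimately show ?thesis
      by (simp add: \<psi>_def complex_eq_iff algebra_simps)
  qed
  have bound: "cmod (\<psi> x) \<le> 2 * norm x" for x
    using cmod_le[of "\<psi> x"] f(2)[of x] i[of x] by (simp add: \<psi>_def)
  have "bounded_linear \<psi>"
  proof (rule bounded_linear_intro)
    show "\<psi> (r *\<^sub>R x) = r *\<^sub>R \<psi> x" for r x
      using scale[of "complex_of_real r" x] by (simp add: scaleR_scaleC scaleR_conv_of_real)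
    show "norm (\<psi> x) \<le> norm x * 2" for x
      using bound[of x] by simp
  qed (rule add)
  moreover have "norm d \<le> cmod (\<psi> d)"
    using abs_Re_le_cmod[of "\<psi> d"] f(3) by (simp add: \<psi>_def)
  ultimately show ?thesis
    using scale bound by (auto simp: bounded_functional_def)
qed

section \<open>Countable sets closed under operations\<close>

text \<open>The common source of a countable subgroup and of a countable dense subset of a separable
  subspace.\<close>

lemma countable_closure_under_operations:
  assumes "countable A" "countable F"
  obtains B :: "'a set" where "countable B" "A \<subseteq> B"
    "\<forall>f\<in>F. \<forall>x\<in>B. \<forall>y\<in>B. f x y \<in> B"
proof -
  define S where "S = rec_nat A (\<lambda>_ X. X \<union> (\<Union>f\<in>F. \<Union>x\<in>X. f x ` X))"
  have S0: "S 0 = A" and SS: "S (Suc n) = S n \<union> (\<Union>f\<in>F. \<Union>x\<in>S n. f x ` S n)" for n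
    by (simp_all add: S_def)
  have cnt: "countable (S n)" for n
    by (induction n) (use assms in \<open>auto simp: S0 SS\<close>)
  have mono: "mono S"
    by (rule mono_iff_le_Suc[THEN iffD2]) (auto simp: SS)
  show ?thesis
  proof (rule that[of "\<Union>n. S n"])
    show "countable (\<Union>n. S n)" using cnt by auto
    show "A \<subseteq> (\<Union>n. S n)" using S0 by auto
    show "\<forall>f\<in>F. \<forall>x\<in>\<Union>n. S n. \<forall>y\<in>\<Union>n. S n. f x y \<in> (\<Union>n. S n)"
    proof (intro ballI)
      fix f x y assume f: "f \<in> F" and "x \<in> (\<Union>n. S n)" "y \<in> (\<Union>n. S n)"
    then obtain m n where "x \<in> S m" "y \<in> S n" by auto
    then have "x \<in> S (max m n)" "y \<in> S (max m n)"
      using monoD[OF mono, of m "max m n"] monoD[OF mono, of n "max m n"] by auto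
    then have "f x y \<in> S (Suc (max m n))"
      using f by (auto simp: SS)
    then show "f x y \<in> (\<Union>n. S n)" by blast
    qed
  qed
qed

lemma countable_infinite_subgroup_exists:
  assumes "infinite (UNIV :: 'g::ab_group_add set)"
  obtains H :: "'g::ab_group_add set" where "countable H" "infinite H" "0 \<in> H"
    "\<And>x y. x \<in> H \<Longrightarrow> y \<in> H \<Longrightarrow> x + y \<in> H" "\<And>x. x \<in> H \<Longrightarrow> - x \<in> H"
proof -
  obtain A :: "'g set" where A: "countable A" "infinite A"
    using infinite_countable_subset'[OF assms] by blast
  obtain H where H: "countable H" "A \<subseteq> H"
    and closed: "\<forall>f\<in>{(-)}. \<forall>x\<in>H. \<forall>y\<in>H. f x y \<in> H"
    by (rule countable_closure_under_operations[OF A(1), of "{(-)}"]) simp_all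
  then have diff: "x - y \<in> H" if "x \<in> H" "y \<in> H" for x y
    using that by blast
  have inf: "infinite H"
    using A(2) H(2) finite_subset by blast
  then obtain a where "a \<in> H"
    using infinite_imp_nonempty by blast
  then have z: "0 \<in> H"
    using diff[of a a] by simp
  have neg: "- x \<in> H" if "x \<in> H" for x
    using diff[OF z that] by simp
  have "x + y \<in> H" if "x \<in> H" "y \<in> H" for x y
    using diff[OF that(1) neg[OF that(2)]] by simp
  with H(1) inf z neg show ?thesis using that by blast
qed

section \<open>Total biorthogonal systems\<close>

lemma bounded_linear_scaleC_left:
  assumes "bounded_linear \<phi>"
  shows "bounded_linear (\<lambda>x. \<phi> x *\<^sub>C (v::'e::complex_banach))"
proof -
  obtain K where K: "\<And>x. norm (\<phi> x) \<le> norm x * K"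
    using bounded_linear.bounded[OF assms] by blast
  interpret bounded_linear \<phi> by fact
  show ?thesis
  proof (rule bounded_linear_intro)
    show "norm (\<phi> x *\<^sub>C v) \<le> norm x * (K * norm v)" for x
      using K[of x] by (simp add: norm_scaleC mult_right_mono flip: mult.assoc)
  qed (simp_all add: add scale scaleC_add_left scaleR_scaleC scaleC_scaleC scaleR_conv_of_real)
qed

lemma bounded_linear_scaleC_right: "bounded_linear (\<lambda>x. a *\<^sub>C (x::'e::complex_banach))"
proof (rule bounded_linear_intro)
  show "norm (a *\<^sub>C x) \<le> norm x * cmod a" for x :: 'e
    by (simp add: norm_scaleC)
qed (simp_all add: scaleC_add_right scaleR_scaleC scaleC_scaleC mult.commute)

text \<open>\<open>D\<close> is a countable set containing an infinite independent set and closed under addition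
  and under multiplication by scalars from a countable dense set; the latter makes its closure
  invariant under all scalars.\<close>

lemma separable_infinite_dimensional_subspace:
  assumes "infinite_dimensional TYPE('e::complex_banach)"
  obtains D :: "'e::complex_banach set" where "countable D" "complex_vector.subspace (closure D)"
    "\<And>B. finite B \<Longrightarrow> \<not> closure D \<subseteq> complex_vector.span B"
proof -
  obtain B0 :: "'e set" where B0: "complex_vector.independent B0" "UNIV \<subseteq> complex_vector.span B0"
    using complex_vector.basis_exists[of UNIV] by blast
  then have "infinite B0"
    using assms by (auto simp: infinite_dimensional_def)
  then obtain A where A: "A \<subseteq> B0" "countable A" "infinite A"
    using infinite_countable_subset' by blast
  obtain Q :: "complex set" where Q: "countable Q" "\<And>X. open X \<Longrightarrow> X \<noteq> {} \<Longrightarrow> \<exists>d\<in>Q. d \<in> X"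
    using countable_dense_exists by blast
  have Q_dense: "closure Q = UNIV"
  proof (rule ccontr)
    assume "closure Q \<noteq> UNIV"
    then have "- closure Q \<noteq> {}" by auto
    then obtain d where "d \<in> Q" "d \<in> - closure Q"
      using Q(2)[of "- closure Q"] by auto
    then show False using closure_subset by blast
  qed
  let ?F = "insert (+) ((\<lambda>q x _. q *\<^sub>C x) ` Q) :: ('e \<Rightarrow> 'e \<Rightarrow> 'e) set"
  have "countable ?F" using Q(1) by simp
  then obtain D where D: "countable D" "A \<subseteq> D"
    and closed: "\<forall>f\<in>?F. \<forall>x\<in>D. \<forall>y\<in>D. f x y \<in> D"
    by (rule countable_closure_under_operations[OF A(2)])
  have add_D: "x + y \<in> D" if "x \<in> D" "y \<in> D" for x y
    using closed that by blast
  have scale_D: "q *\<^sub>C x \<in> D" if "q \<in> Q" "x \<in> D" for q x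
    using closed that by auto
  have add: "x + y \<in> closure D" if xy: "x \<in> closure D" "y \<in> closure D" for x y
  proof -
    have "(\<lambda>(x, y). x + y) ` closure (D \<times> D) \<subseteq> closure D"
      by (rule image_closure_subset)
        (use add_D closure_subset[of D] in \<open>auto simp: case_prod_unfold intro!: continuous_intros\<close>)
    then show ?thesis
      using xy by (auto simp: closure_Times)
  qed
  have scale_Q: "q *\<^sub>C x \<in> closure D" if q: "q \<in> Q" and x: "x \<in> closure D" for q x
  proof -
    have "(\<lambda>x. q *\<^sub>C x) ` closure D \<subseteq> closure D"
      by (rule image_closure_subset)
        (use scale_D[OF q] closure_subset[of D] in
          \<open>auto intro: linear_continuous_on[OF bounded_linear_scaleC_right]\<close>)
    then show ?thesis using x by blast
  qed
  have scale: "a *\<^sub>C x \<in> closure D" if x: "x \<in> closure D" for a x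
  proof -
    have "(\<lambda>a. a *\<^sub>C x) ` closure Q \<subseteq> closure D"
      by (rule image_closure_subset)
        (use scale_Q[OF _ x] in
          \<open>auto intro: linear_continuous_on[OF bounded_linear_scaleC_left[OF bounded_linear_ident]]\<close>)
    then show ?thesis using Q_dense by blast
  qed
  obtain a where "a \<in> A"
    using A(3) infinite_imp_nonempty by blast
  then have "a \<in> closure D"
    using D(2) closure_subset by blast
  then have "0 \<in> closure D"
    using scale[of a 0] by simp
  with add scale have "complex_vector.subspace (closure D)"
    by (auto simp: complex_vector.subspace_def)
  moreover have "\<not> closure D \<subseteq> complex_vector.span B" if "finite B" for B
  proof
    assume "closure D \<subseteq> complex_vector.span B"
    then have "A \<subseteq> complex_vector.span B"
      using D(2) closure_subset by blast
    then have "finite A"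
      using complex_vector.independent_span_bound[OF that
        complex_vector.independent_mono[OF B0(1) A(1)]] by simp
    with A(3) show False by simp
  qed
  ultimately show ?thesis
    using that D(1) by blast
qed


text \<open>Let \<open>N d\<close> be norming for \<open>d\<close>.  If all \<open>N d\<close> with \<open>d \<in> D\<close> vanish at \<open>x\<close>, then
  \<open>norm d \<le> \<bar>N d (d - x)\<bar> \<le> 2 * norm (d - x)\<close>, and \<open>d\<close> can be taken arbitrarily close to \<open>x\<close>.\<close>

lemma separable_total_functionals:
  fixes D :: "'e::complex_banach set"
  assumes "countable D" "D \<noteq> {}"
  obtains \<psi> :: "nat \<Rightarrow> 'e \<Rightarrow> complex" where "\<And>n. bounded_functional (\<psi> n)"
    "\<And>x. x \<in> closure D \<Longrightarrow> (\<And>n. \<psi> n x = 0) \<Longrightarrow> x = 0"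
proof -
  have "\<forall>d::'e. \<exists>\<psi>. bounded_functional \<psi> \<and> (\<forall>x. cmod (\<psi> x) \<le> 2 * norm x) \<and>
      norm d \<le> cmod (\<psi> d)"
    using norming_functional by (rule allI)
  then have "\<exists>N. \<forall>d::'e. bounded_functional (N d) \<and> (\<forall>x. cmod (N d x) \<le> 2 * norm x) \<and>
      norm d \<le> cmod (N d d)"
    by (rule choice)
  then obtain N :: "'e \<Rightarrow> 'e \<Rightarrow> complex"
    where "\<forall>d. bounded_functional (N d) \<and> (\<forall>x. cmod (N d x) \<le> 2 * norm x) \<and>
      norm d \<le> cmod (N d d)"
    by (rule exE)
  then have N: "bounded_functional (N d)" "cmod (N d x) \<le> 2 * norm x" "norm d \<le> cmod (N d d)" for d x
    by auto
  show ?thesis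
  proof (rule that[of "\<lambda>n. N (from_nat_into D n)"])
    show "bounded_functional (N (from_nat_into D n))" for n
      by (rule N)
    fix x assume x: "x \<in> closure D" and zero: "\<And>n. N (from_nat_into D n) x = 0"
    have zero: "N d x = 0" if "d \<in> D" for d
      using zero from_nat_into_surj[OF assms(1) that] by auto
    have "norm x \<le> \<epsilon>" if "0 < \<epsilon>" for \<epsilon>
    proof -
      have "0 < \<epsilon> / 3" using that by simp
      then have "\<exists>d\<in>D. dist d x < \<epsilon> / 3"
        using x unfolding closure_approachable by blast
      then obtain d where d: "d \<in> D" "dist d x < \<epsilon> / 3"
        by blast
      have "N d (d - x) = N d d - N d x"
        using N(1)[of d] linear_diff[of "N d" d x]
        by (simp add: bounded_functional_def bounded_linear.linear)
      then have "norm d \<le> 2 * norm (d - x)"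
        using N(2)[of d "d - x"] N(3)[of d] zero[OF d(1)] by simp
      then show ?thesis
        using d(2) norm_triangle_ineq2[of x d] by (simp add: dist_norm norm_minus_commute)
    qed
    then show "x = 0"
      using field_le_epsilon[of "norm x" 0] by simp
  qed
qed

text \<open>Totality means that the functionals separate the points of \<open>E0\<close>.\<close>

definition total_biorthogonal_system ::
    "'e::complex_banach set \<Rightarrow> 'i set \<Rightarrow> ('i \<Rightarrow> 'e \<Rightarrow> complex) \<Rightarrow> ('i \<Rightarrow> 'e) \<Rightarrow> bool"
  where "total_biorthogonal_system E0 I \<phi> e \<longleftrightarrow>
    (\<forall>n. bounded_functional (\<phi> n)) \<and> (\<forall>n\<in>I. e n \<in> E0) \<and>
    (\<forall>m\<in>I. \<forall>n\<in>I. \<phi> m (e n) = (if m = n then 1 else 0)) \<and>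
    (\<forall>x\<in>E0. (\<forall>n\<in>I. \<phi> n x = 0) \<longrightarrow> x = 0)"

text \<open>Gram--Schmidt: on \<open>E0\<close>, \<open>R n\<close> is the projection along \<open>e 0, \<dots>, e (n - 1)\<close> onto
  the common kernel of \<open>\<phi> 0, \<dots>, \<phi> (n - 1)\<close>, and \<open>\<phi> n = \<psi> n \<circ> R n\<close>
  is \<open>\<psi> n\<close> corrected so as to vanish at the earlier vectors.  Choosing \<open>e n\<close> in the range of \<open>R n\<close> makes the earlier functionals vanish at it, so
  biorthogonality holds on both sides.  An index is discarded (\<open>e n = 0\<close>) when
  \<open>\<phi> n\<close> vanishes on \<open>E0\<close>, that is, when \<open>\<psi> n\<close> depends there on its predecessors; hence the
  remaining functionals still separate points.  Finitely many indices
  cannot remain, as then every \<open>x \<in> E0\<close> would be the combination \<open>\<Sum>i\<in>I. \<phi> i x *\<^sub>C e i\<close>.\<close>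

lemma biorthogonal_system_of_total_functionals:
  fixes E0 :: "'e::complex_banach set" and \<psi> :: "nat \<Rightarrow> 'e \<Rightarrow> complex"
  assumes E0: "complex_vector.subspace E0"
    and inf: "\<And>B. finite B \<Longrightarrow> \<not> E0 \<subseteq> complex_vector.span B"
    and \<psi>: "\<And>n. bounded_functional (\<psi> n)"
    and total: "\<And>x. x \<in> E0 \<Longrightarrow> (\<And>n. \<psi> n x = 0) \<Longrightarrow> x = 0"
  shows "\<exists>I \<phi> e. infinite (I :: nat set) \<and> total_biorthogonal_system E0 I \<phi> e"
proof -
  define pick where "pick T f = (if \<exists>y\<in>E0. f (T y) \<noteq> 0
      then (let y = (SOME y. y \<in> E0 \<and> f (T y) \<noteq> 0) in inverse (f (T y)) *\<^sub>C T y) else 0)"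
    for T :: "'e \<Rightarrow> 'e" and f :: "'e \<Rightarrow> complex"
  define R where "R = rec_nat (\<lambda>x. x) (\<lambda>n T x. T x - \<psi> n (T x) *\<^sub>C pick T (\<psi> n))"
  define e where "e n = pick (R n) (\<psi> n)" for n
  define \<phi> where "\<phi> n x = \<psi> n (R n x)" for n x
  define I where "I = {n. \<exists>x\<in>E0. \<phi> n x \<noteq> 0}"
  have R_0: "R 0 x = x" and R_Suc: "R (Suc n) x = R n x - \<phi> n x *\<^sub>C e n" for n x
    by (simp_all add: R_def e_def \<phi>_def)
  have e_I: "\<exists>y\<in>E0. \<phi> n y \<noteq> 0 \<and> e n = inverse (\<phi> n y) *\<^sub>C R n y" if "n \<in> I" for n
  proof -
    have ex: "\<exists>y. y \<in> E0 \<and> \<psi> n (R n y) \<noteq> 0"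
      using that by (auto simp: I_def \<phi>_def)
    define y where "y = (SOME y. y \<in> E0 \<and> \<psi> n (R n y) \<noteq> 0)"
    have "y \<in> E0 \<and> \<psi> n (R n y) \<noteq> 0"
      unfolding y_def using ex by (rule someI_ex)
    moreover have "e n = inverse (\<psi> n (R n y)) *\<^sub>C R n y"
      using ex by (auto simp: e_def pick_def y_def Let_def)
    ultimately show ?thesis by (auto simp: \<phi>_def)
  qed
  have e_not_I: "e n = 0" if "n \<notin> I" for n
    using that by (auto simp: e_def pick_def I_def \<phi>_def)
  have \<psi>_lin: "bounded_linear (\<psi> n)" and \<psi>_scale: "\<psi> n (a *\<^sub>C x) = a * \<psi> n x" for n a x
    using \<psi>[of n] by (auto simp: bounded_functional_def)
  have R_bl: "bounded_linear (R n) \<and> (\<forall>a x. R n (a *\<^sub>C x) = a *\<^sub>C R n x)" for n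
  proof (induction n)
    case 0
    then show ?case by (simp add: R_0 [abs_def] bounded_linear_ident)
  next
    case (Suc n)
    have "bounded_linear (\<lambda>x. \<phi> n x *\<^sub>C e n)"
      unfolding \<phi>_def using Suc
      by (intro bounded_linear_scaleC_left bounded_linear_compose[OF \<psi>_lin]) simp
    then have "bounded_linear (R (Suc n))"
      unfolding R_Suc [abs_def] using Suc by (intro bounded_linear_sub) simp
    moreover have "R (Suc n) (a *\<^sub>C x) = a *\<^sub>C R (Suc n) x" for a x
      using Suc by (simp add: R_Suc \<phi>_def \<psi>_scale scaleC_scaleC complex_vector.scale_right_diff_distrib)
    ultimately show ?case by blast
  qed
  have \<phi>: "bounded_functional (\<phi> n)" for n
    unfolding bounded_functional_def \<phi>_def
    using R_bl[of n] by (auto simp: \<psi>_scale intro: bounded_linear_compose[OF \<psi>_lin])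
  have \<phi>_diff: "\<phi> n (x - y) = \<phi> n x - \<phi> n y" and \<phi>_scale: "\<phi> n (a *\<^sub>C x) = a * \<phi> n x"
    and \<phi>_sum: "\<phi> n (sum f J) = (\<Sum>j\<in>J. \<phi> n (f j))" for n a x y and f :: "nat \<Rightarrow> 'e" and J
    using \<phi>[of n] linear_diff[of "\<phi> n"] linear_sum[of "\<phi> n"]
    by (auto simp: bounded_functional_def bounded_linear.linear)
  have \<phi>_0: "\<phi> n 0 = 0" for n
    using \<phi>_diff[of n 0 0] by simp
  have R_E0: "\<forall>x\<in>E0. R n x \<in> E0" and e_E0: "e n \<in> E0" for n
  proof -
    have e_step: "e n \<in> E0" if "\<forall>x\<in>E0. R n x \<in> E0" for n
      using e_I[of n] e_not_I[of n] that complex_vector.subspace_0[OF E0]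
        complex_vector.subspace_scale[OF E0] by metis
    show R: "\<forall>x\<in>E0. R n x \<in> E0" for n
    proof (induction n)
      case (Suc n)
      then show ?case
        using e_step[OF Suc]
        by (simp add: R_Suc complex_vector.subspace_diff complex_vector.subspace_scale E0)
    qed (simp add: R_0)
    show "e n \<in> E0" by (rule e_step[OF R])
  qed
  \<comment> \<open>It follows that \<open>R n\<close> fixes every vector at which the first \<open>n\<close> functionals vanish.\<close>
  have R_eq: "R n x = x - (\<Sum>m<n. \<phi> m x *\<^sub>C e m)" for n x
    by (induction n) (simp_all add: R_0 R_Suc)
  have vanish: "m < n \<Longrightarrow> x \<in> E0 \<Longrightarrow> \<phi> m (R n x) = 0" for m n x
  proof (induction n arbitrary: m x)
    case (Suc n)
    have idem: "\<phi> n (R n y) = \<phi> n y" if "y \<in> E0" for y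
      unfolding \<phi>_def using R_eq[of n "R n y"] Suc.IH that by simp
    show ?case
    proof (cases "n \<in> I")
      case False
      then have "\<phi> n x = 0" using Suc.prems by (auto simp: I_def)
      then show ?thesis
        using Suc idem[of x] by (cases "m = n") (auto simp: R_Suc \<phi>_diff \<phi>_scale)
    next
      case True
      then obtain y where y: "y \<in> E0" "\<phi> n y \<noteq> 0" "e n = inverse (\<phi> n y) *\<^sub>C R n y"
        using e_I by blast
      then have "\<phi> m (e n) = (if m = n then 1 else 0)"
        using Suc idem[of y] by (auto simp: \<phi>_scale less_Suc_eq)
      then show ?thesis
        using Suc idem[of x] by (auto simp: R_Suc \<phi>_diff \<phi>_scale less_Suc_eq)
    qed
  qed simp
  have R_idem: "R n (R n x) = R n x" if "x \<in> E0" for n x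
    using R_eq[of n "R n x"] vanish that by simp
  have biorth: "\<phi> m (e n) = (if m = n then 1 else 0)" if n: "n \<in> I" for m n
  proof -
    obtain y where y: "y \<in> E0" "\<phi> n y \<noteq> 0" "e n = inverse (\<phi> n y) *\<^sub>C R n y"
      using e_I[OF n] by blast
    have Rn: "R n (e n) = e n"
      using R_bl[of n] R_idem[OF y(1)] by (simp add: y(3))
    have diag: "\<phi> n (e n) = 1"
      using y(2) R_idem[OF y(1)] by (simp add: y(3) \<phi>_scale) (simp add: \<phi>_def)
    consider "m < n" | "m = n" | "n < m" by linarith
    then show ?thesis
    proof cases
      case 1
      then show ?thesis using vanish[OF 1 y(1)] by (simp add: y(3) \<phi>_scale)
    next
      case 2
      then show ?thesis using diag by simp
    next
      case 3
      have start: "R (Suc n) (e n) = 0"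
        by (simp add: R_Suc Rn diag scaleC_one)
      have step: "R (Suc k) (e n) = 0" if "R k (e n) = 0" for k
        using that \<phi>_0[of k] linear_0[OF bounded_linear.linear[OF \<psi>_lin]]
        by (simp add: R_Suc \<phi>_def)
      have "R k (e n) = 0" if "Suc n \<le> k" for k
        using that by (induction k rule: dec_induct) (simp_all add: start step)
      then have "R m (e n) = 0"
        using 3 by simp
      then show ?thesis
        using 3 linear_0[OF bounded_linear.linear[OF \<psi>_lin]] by (simp add: \<phi>_def)
    qed
  qed
  have \<phi>_total: "x = 0" if x: "x \<in> E0" and zero: "\<And>n. n \<in> I \<Longrightarrow> \<phi> n x = 0" for x
  proof (rule total[OF x])
    fix n
    have "\<phi> m x = 0" for m
      using zero x by (cases "m \<in> I") (auto simp: I_def)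
    then have "R n x = x" "\<phi> n x = 0"
      by (simp_all add: R_eq)
    then show "\<psi> n x = 0"
      by (simp add: \<phi>_def)
  qed
  have "infinite I"
  proof
    assume fin: "finite I"
    have "E0 \<subseteq> complex_vector.span (e ` I)"
    proof
      fix x assume x: "x \<in> E0"
      let ?s = "\<Sum>i\<in>I. \<phi> i x *\<^sub>C e i"
      have "?s \<in> E0"
        by (intro complex_vector.subspace_sum complex_vector.subspace_scale E0 e_E0)
      moreover have "\<phi> n (x - ?s) = 0" if "n \<in> I" for n
      proof -
        have "(\<Sum>j\<in>I. \<phi> j x * \<phi> n (e j)) = (\<Sum>j\<in>I. if j = n then \<phi> n x else 0)"
          by (rule sum.cong) (auto simp: biorth)
        then show ?thesis
          using that fin by (simp add: \<phi>_diff \<phi>_sum \<phi>_scale)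
      qed
      ultimately have "x - ?s = 0"
        using x by (intro \<phi>_total complex_vector.subspace_diff E0) auto
      moreover have "?s \<in> complex_vector.span (e ` I)"
        by (intro complex_vector.span_sum complex_vector.span_scale complex_vector.span_base) auto
      ultimately show "x \<in> complex_vector.span (e ` I)" by simp
    qed
    then show False using inf fin by blast
  qed
  moreover have "total_biorthogonal_system E0 I \<phi> e"
    using \<phi> e_E0 biorth \<phi>_total by (simp add: total_biorthogonal_system_def)
  ultimately show ?thesis by blast
qed

text \<open>Multiplying \<open>e n\<close> and dividing \<open>\<phi> n\<close> by the same large number keeps the system biorthogonal
  and makes the norms of the functionals tend to \<open>0\<close>.\<close>

lemma biorthogonal_system_exists:
  assumes "infinite_dimensional TYPE('e::complex_banach)"
  obtains E0 :: "'e::complex_banach set" and I \<phi> e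
  where "closed E0" "complex_vector.subspace E0" "infinite (I :: nat set)"
    "total_biorthogonal_system E0 I \<phi> e" "\<forall>n x. real (Suc n) * cmod (\<phi> n x) \<le> norm x"
proof -
  obtain D :: "'e set" where D: "countable D" "complex_vector.subspace (closure D)"
      "\<And>B. finite B \<Longrightarrow> \<not> closure D \<subseteq> complex_vector.span B"
    using separable_infinite_dimensional_subspace[OF assms] by blast
  have "D \<noteq> {}"
    using D(3)[of "{}"] by auto
  then obtain \<psi> :: "nat \<Rightarrow> 'e \<Rightarrow> complex" where \<psi>: "\<And>n. bounded_functional (\<psi> n)"
      "\<And>x. x \<in> closure D \<Longrightarrow> (\<And>n. \<psi> n x = 0) \<Longrightarrow> x = 0"
    using separable_total_functionals[OF D(1)] by blast
  have "\<exists>I \<phi> e. infinite (I :: nat set) \<and> total_biorthogonal_system (closure D) I \<phi> e"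
    using D(2,3) \<psi> by (rule biorthogonal_system_of_total_functionals)
  then obtain I :: "nat set" and \<phi> e
    where I: "infinite I" and sys: "total_biorthogonal_system (closure D) I \<phi> e"
    by blast
  then have \<phi>: "bounded_functional (\<phi> n)" for n
    by (simp add: total_biorthogonal_system_def)
  have "\<exists>K>0. \<forall>x. cmod (\<phi> n x) \<le> norm x * K" for n
    using \<phi>[of n] bounded_linear.pos_bounded[of "\<phi> n"] by (auto simp: bounded_functional_def)
  then obtain K where K: "\<And>n. 0 < K n" "\<And>n x. cmod (\<phi> n x) \<le> norm x * K n"
    by metis
  define c where "c n = complex_of_real (real (Suc n) * K n)" for n
  have c: "c n \<noteq> 0" for n
    using K(1)[of n] by (simp add: c_def del: of_nat_Suc)
  show ?thesis
  proof (rule that[of "closure D" I "\<lambda>n x. \<phi> n x / c n" "\<lambda>n. c n *\<^sub>C e n"])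
    have "bounded_functional (\<lambda>x. \<phi> n x / c n)" for n
      using \<phi>[of n] by (auto simp: bounded_functional_def intro: bounded_linear_compose[OF bounded_linear_divide])
    moreover have "\<phi> m (c n *\<^sub>C e n) = c n * \<phi> m (e n)" for m n
      using \<phi>[of m] by (simp add: bounded_functional_def)
    ultimately show "total_biorthogonal_system (closure D) I (\<lambda>n x. \<phi> n x / c n) (\<lambda>n. c n *\<^sub>C e n)"
      using sys c D(2) by (auto simp: total_biorthogonal_system_def complex_vector.subspace_scale)
    show "\<forall>n x. real (Suc n) * cmod (\<phi> n x / c n) \<le> norm x"
    proof (intro allI)
      fix n x
      show "real (Suc n) * cmod (\<phi> n x / c n) \<le> norm x"
        using K(1)[of n] K(2)[of n x]
        by (simp add: c_def norm_divide norm_mult divide_simps del: of_nat_Suc)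
    qed
  qed (use D I in auto)
qed

section \<open>A variety without exponentials\<close>

text \<open>A condition on the values at two points involves only a finite set, on which the topology
  controls the function uniformly.\<close>

lemma closedin_pointwise_closed_conditions:
  fixes S :: "'i \<Rightarrow> ('e::real_normed_vector \<times> 'e) set"
  assumes "\<And>i. i \<in> J \<Longrightarrow> closed (S i)"
  shows "closedin finite_convergence_topology {f. \<forall>i\<in>J. (f (x i), f (y i)) \<in> S i}"
  unfolding closedin_def
proof (intro conjI)
  let ?V = "{f. \<forall>i\<in>J. (f (x i), f (y i)) \<in> S i}"
  show "openin finite_convergence_topology (topspace finite_convergence_topology - ?V)"
    unfolding openin_finite_convergence_topology
  proof
    fix f assume "f \<in> topspace finite_convergence_topology - ?V"
    then obtain i where i: "i \<in> J" "(f (x i), f (y i)) \<in> - S i" by auto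
    have "open (- S i)" using assms i(1) by auto
    then obtain \<epsilon> where \<epsilon>: "0 < \<epsilon>" "\<And>z. dist z (f (x i), f (y i)) < \<epsilon> \<Longrightarrow> z \<in> - S i"
      using i(2) by (metis open_dist)
    have "h \<notin> ?V" if h: "\<forall>t\<in>{x i, y i}. norm (h t - f t) < \<epsilon> / 2" for h
    proof -
      have "dist (h (x i), h (y i)) (f (x i), f (y i))
          \<le> norm (h (x i) - f (x i)) + norm (h (y i) - f (y i))"
        by (simp add: dist_norm norm_Pair sqrt_sum_squares_le_sum)
      also have "\<dots> < \<epsilon>" using h by simp
      finally show ?thesis using \<epsilon>(2) i(1) by auto
    qed
    then show "\<exists>K \<epsilon>. finite K \<and> 0 < \<epsilon> \<and> {h. \<forall>x\<in>K. norm (h x - f x) < \<epsilon>}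
        \<subseteq> topspace finite_convergence_topology - ?V"
      using \<epsilon>(1) by (intro exI[of _ "{x i, y i}"] exI[of _ "\<epsilon> / 2"]) auto
  qed
qed simp

lemma exponential_zero:
  assumes "exponential m"
  shows "m 0 = 1"
proof -
  obtain x where "m x \<noteq> 0"
    using assms by (auto simp: exponential_def fun_eq_iff)
  moreover have "m x = m x * m 0"
    using assms unfolding exponential_def by (metis add.right_neutral)
  ultimately show ?thesis by simp
qed

theorem theorem17:
  assumes "infinite (UNIV :: 'g::ab_group_add set)"
    and "infinite_dimensional TYPE('e::complex_banach)"
  shows "\<not> spectral_analysis TYPE('g) TYPE('e)"
proof -
  obtain H :: "'g set" where H: "countable H" "infinite H" "0 \<in> H"
    and H_add: "\<And>x y. x \<in> H \<Longrightarrow> y \<in> H \<Longrightarrow> x + y \<in> H"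
    and H_minus: "\<And>x. x \<in> H \<Longrightarrow> - x \<in> H"
    using countable_infinite_subgroup_exists[OF assms(1)] by blast
  obtain E0 :: "'e set" and I \<phi> e where E0: "closed E0" "complex_vector.subspace E0"
    and I: "infinite (I :: nat set)" and sys: "total_biorthogonal_system E0 I \<phi> e"
    and small: "\<forall>n x. real (Suc n) * cmod (\<phi> n x) \<le> norm x"
    using assms(2) by (rule biorthogonal_system_exists)
  have \<phi>: "bounded_functional (\<phi> n)" for n
    using sys by (simp add: total_biorthogonal_system_def)
  have e: "e n \<in> E0" if "n \<in> I" for n
    using sys that by (simp add: total_biorthogonal_system_def)
  have biorth: "\<phi> m (e n) = (if m = n then 1 else 0)" if "m \<in> I" "n \<in> I" for m n
    using sys that by (simp add: total_biorthogonal_system_def)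
  have total: "x = 0" if "x \<in> E0" "\<And>n. n \<in> I \<Longrightarrow> \<phi> n x = 0" for x
    using sys that by (simp add: total_biorthogonal_system_def)
  obtain \<sigma> where \<sigma>: "bij_betw \<sigma> H I"
    using bij_betw_trans[OF to_nat_on_infinite[OF H(1,2)] bij_enumerate[OF I]] by blast
  have \<sigma>_I: "\<sigma> h \<in> I" if "h \<in> H" for h
    using \<sigma> that by (auto simp: bij_betw_def)
  have \<sigma>_eq: "\<sigma> h = \<sigma> k \<longleftrightarrow> h = k" if "h \<in> H" "k \<in> H" for h k
    using \<sigma> that by (auto simp: bij_betw_def inj_on_def)
  \<comment> \<open>The defining conditions of \<open>V\<close>, written as closed relations between the values at \<open>g\<close> and
    \<open>g + k\<close>; \<open>V_iff\<close> gives their readable form.\<close>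
  define J where "J = (UNIV :: 'g set) \<times> H \<times> H"
  define S where "S = (\<lambda>(g::'g, h, k). {z \<in> E0 \<times> E0. \<phi> (\<sigma> (h + k)) (snd z) = \<phi> (\<sigma> h) (fst z)})"
  define V where "V = {f :: 'g \<Rightarrow> 'e. \<forall>i\<in>J. (f (fst i), f (fst i + snd (snd i))) \<in> S i}"
  have V_iff: "f \<in> V \<longleftrightarrow> (\<forall>g. f g \<in> E0) \<and>
      (\<forall>g. \<forall>h\<in>H. \<forall>k\<in>H. \<phi> (\<sigma> (h + k)) (f (g + k)) = \<phi> (\<sigma> h) (f g))" for f
    using H(3) by (auto simp: V_def J_def S_def)
  have \<phi>_lin: "linear (\<phi> n)" and \<phi>_scale: "\<phi> n (a *\<^sub>C x) = a * \<phi> n x"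
    and \<phi>_cont: "continuous_on A (\<phi> n)" for n a x A
    using \<phi>[of n] by (auto simp: bounded_functional_def bounded_linear.linear linear_continuous_on)
  have "closed (S i)" for i
  proof -
    obtain g h k where i: "i = (g, h, k)" by (cases i)
    have "S i = (E0 \<times> E0) \<inter> {z. \<phi> (\<sigma> (h + k)) (snd z) = \<phi> (\<sigma> h) (fst z)}"
      by (auto simp: S_def i)
    moreover have "continuous_on UNIV (\<lambda>z. \<phi> n (snd z))" "continuous_on UNIV (\<lambda>z. \<phi> n (fst z))" for n
      by (auto intro!: continuous_on_compose2[OF \<phi>_cont[of UNIV]] continuous_intros)
    ultimately show ?thesis
      using E0(1) by (auto intro!: closed_Int closed_Times closed_Collect_eq)
  qed
  then have closed: "closedin finite_convergence_topology V"
    unfolding V_def by (intro closedin_pointwise_closed_conditions)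
  have sub: "complex_vector.subspace V"
    unfolding complex_vector.subspace_def
  proof (intro conjI ballI allI)
    show "0 \<in> V"
      using complex_vector.subspace_0[OF E0(2)] linear_0[OF \<phi>_lin] by (simp add: V_iff)
    show "f + f' \<in> V" if "f \<in> V" "f' \<in> V" for f f'
      using that complex_vector.subspace_add[OF E0(2)] linear_add[OF \<phi>_lin] by (simp add: V_iff)
    show "a *\<^sub>C f \<in> V" if "f \<in> V" for a f
      using that complex_vector.subspace_scale[OF E0(2)] \<phi>_scale by (simp add: V_iff scaleC_fun_def)
  qed
  have "translate t f \<in> V" if f: "f \<in> V" for f t
    unfolding V_iff translate_def
  proof (intro conjI allI ballI)
    show "f (g + t) \<in> E0" for g
      using f by (simp add: V_iff)
    fix g h k assume "h \<in> H" "k \<in> H"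
    then have "\<phi> (\<sigma> (h + k)) (f ((g + t) + k)) = \<phi> (\<sigma> h) (f (g + t))"
      using f unfolding V_iff by blast
    then show "\<phi> (\<sigma> (h + k)) (f (g + k + t)) = \<phi> (\<sigma> h) (f (g + t))"
      by (simp add: add.assoc add.commute[of k t])
  qed
  with closed sub have variety: "variety V"
    by (simp add: variety_def)
  \<comment> \<open>Membership in \<open>H\<close> is invariant under shifts by \<open>k \<in> H\<close>, so the extension by \<open>0\<close> satisfies
    the conditions on every coset.\<close>
  define f0 where "f0 g = (if g \<in> H then e (\<sigma> g) else 0)" for g
  have "f0 \<in> V"
    unfolding V_iff
  proof (intro conjI allI ballI)
    show "f0 g \<in> E0" for g
      using e \<sigma>_I complex_vector.subspace_0[OF E0(2)] by (simp add: f0_def)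
    fix g h k assume hk: "h \<in> H" "k \<in> H"
    have "g + k \<in> H \<longleftrightarrow> g \<in> H"
      using H_add[of g k] H_add[of "g + k" "- k"] H_minus hk by auto
    then show "\<phi> (\<sigma> (h + k)) (f0 (g + k)) = \<phi> (\<sigma> h) (f0 g)"
      using hk by (auto simp: f0_def linear_0[OF \<phi>_lin] biorth \<sigma>_I \<sigma>_eq H_add)
  qed
  moreover have "f0 \<noteq> 0"
  proof
    assume "f0 = 0"
    then have "e (\<sigma> 0) = 0" using H(3) by (metis f0_def zero_fun_apply)
    then show False
      using biorth[of "\<sigma> 0" "\<sigma> 0"] \<sigma>_I[OF H(3)] linear_0[OF \<phi>_lin] by simp
  qed
  ultimately have "V \<noteq> {0}" by blast
  moreover have False if m: "exponential m" and v: "v \<noteq> 0" and mv: "(\<lambda>x. m x *\<^sub>C v) \<in> V" for m v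
  proof -
    have m0: "m 0 = 1" and mult: "m (x + y) = m x * m y" for x y
      using m exponential_zero by (auto simp: exponential_def)
    have inv: "m x * m (- x) = 1" for x
      using mult[of x "- x"] m0 by simp
    define a where "a = \<phi> (\<sigma> 0) v"
    have coeff: "m k * \<phi> (\<sigma> k) v = a" if "k \<in> H" for k
    proof -
      have "\<phi> (\<sigma> (0 + k)) (m (0 + k) *\<^sub>C v) = \<phi> (\<sigma> 0) (m 0 *\<^sub>C v)"
        using mv that H(3) unfolding V_iff by blast
      then show ?thesis by (simp add: m0 \<phi>_scale a_def)
    qed
    have "v \<in> E0"
      using mv m0 unfolding V_iff by (metis scaleC_one)
    moreover have "\<phi> n v = 0" if "a = 0" "n \<in> I" for n
    proof -
      obtain k where "k \<in> H" "n = \<sigma> k"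
        using \<sigma> \<open>n \<in> I\<close> by (auto simp: bij_betw_def)
      then show ?thesis
        using coeff[of k] inv[of k] \<open>a = 0\<close> by auto
    qed
    ultimately have a: "a \<noteq> 0"
      using total[of v] v by blast
    \<comment> \<open>Where \<open>m\<close> is at most \<open>1\<close> in modulus, the coordinates of \<open>v\<close> are bounded away from \<open>0\<close>,
      which the decay of the functionals allows for finitely many indices only.\<close>
    define N where "N = {k \<in> H. cmod (m k) \<le> 1}"
    have "real (\<sigma> k) \<le> norm v / cmod a" if k: "k \<in> N" for k
    proof -
      have "cmod a = cmod (m k) * cmod (\<phi> (\<sigma> k) v)"
        using coeff[of k] k by (metis (no_types, lifting) N_def mem_Collect_eq norm_mult)
      also have "\<dots> \<le> cmod (\<phi> (\<sigma> k) v)"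
        using k by (simp add: N_def mult_left_le_one_le)
      finally have "real (\<sigma> k) * cmod a \<le> real (Suc (\<sigma> k)) * cmod (\<phi> (\<sigma> k) v)"
        by (intro mult_mono) auto
      also have "\<dots> \<le> norm v" using small by blast
      finally show ?thesis using a by (simp add: pos_le_divide_eq)
    qed
    then have "\<sigma> ` N \<subseteq> {..nat \<lfloor>norm v / cmod a\<rfloor>}"
      by (auto simp: le_nat_floor)
    then have "finite (\<sigma> ` N)"
      using finite_subset by blast
    moreover have "inj_on \<sigma> N"
      using \<sigma> by (auto simp: N_def bij_betw_def inj_on_def)
    ultimately have "finite N"
      using finite_imageD by blast
    moreover have "H \<subseteq> N \<union> uminus ` N"
    proof
      fix k assume k: "k \<in> H"
      have "cmod (m k) * cmod (m (- k)) = 1"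
        using inv[of k] by (metis norm_mult norm_one)
      then have "cmod (m k) \<le> 1 \<or> cmod (m (- k)) \<le> 1"
        using less_1_mult[of "cmod (m k)" "cmod (m (- k))"] by linarith
      then have "k \<in> N \<or> - k \<in> N"
        using k H_minus by (auto simp: N_def)
      then show "k \<in> N \<union> uminus ` N"
        by (metis UnI1 UnI2 add.inverse_inverse image_eqI)
    qed
    ultimately show False
      using H(2) finite_subset by blast
  qed
  ultimately show ?thesis
    using variety unfolding spectral_analysis_def by blast
qed

end
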